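(* Let $\bar x\in\mathcal{SE}$. Suppose that: (i) $f$ is strictly $B$-differentiable at $\bar x$, uniformly on $K$, with family of derivatives $\{D_Bf(\bar x,z):\ z\in K\}$; (ii) the family of mappings $\{D_Bf(\bar x,z):\ z\in K\}$ is equicontinuous at each point of $\mathbb{R}^n$. Then $$T(\bar x;\mathcal{SE})\subseteq\bigcap_{z\in K}D_Bf(\bar x,z)^{-1}\big(T(f(\bar x,z);C)\big)\cap T(\bar x;K).$$
   Context: Setting: $f:\mathbb{R}^n\times\mathbb{R}^n\to\mathbb{R}^m$ is a mapping, $C\subset\mathbb{R}^m$ is a nontrivial closed, convex, pointed cone, and $K\subseteq\mathbb{R}^n$ is a nonempty closed set. The strong vector equilibrium problem asks for $x\in K$ with $f(x,z)\in C$ for all $z\in K$; its solution set is $\mathcal{SE}=\{x\in K:\ f(x,z)\in C\ \ \forall z\in K\}$. Notation: $B(x;r)$ is the closed ball of center $x$ and radius $r$. For a set $S\subseteq\mathbb{R}^d$ and $\bar s\in S$, the contingent cone to $S$ at $\bar s$ is $T(\bar s;S)=\{v\in\mathbb{R}^d:\ \exists v_k\to v,\ \exists t_k\downarrow0:\ \bar s+t_kv_k\in S\ \forall k\in\mathbb{N}\}$. $\mathcal{PH}(\mathbb{R}^n,\mathbb{R}^m)$ is the space of continuous positively homogeneous mappings from $\mathbb{R}^n$ to $\mathbb{R}^m$. $f$ is strictly $B$-differentiable at $\bar x\in K$, uniformly on $K$, if there is a family $\{D_Bf(\bar x,z)\in\mathcal{PH}(\mathbb{R}^n,\mathbb{R}^m):\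 z\in K\}$ such that for every $\epsilon>0$ there is $\delta_\epsilon>0$ with $$\sup_{z\in K}\frac{\|f(x_1,z)-f(x_2,z)-D_Bf(\bar x,z)(x_1-x_2)\|}{\|x_1-x_2\|}<\epsilon\quad\forall x_1,x_2\in B(\bar x;\delta_\epsilon),\ x_1\ne x_2.$$ $D_Bf(\bar x,z)^{-1}(A)$ denotes the preimage $\{v\in\mathbb{R}^n:\ D_Bf(\bar x,z)(v)\in A\}$. *)

theory Defs
  imports "HOL-Analysis.Analysis"
begin

text \<open>The bifunction \<open>f : R^n \<times> R^n \<rightarrow> R^m\<close> is curried throughout.\<close>

definition pointed :: "'a::real_vector set \<Rightarrow> bool" where
  "pointed C \<longleftrightarrow> C \<inter> uminus ` C = {0}"

definition strong_eq_solutions ::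
    "('a \<Rightarrow> 'a \<Rightarrow> 'b) \<Rightarrow> 'b set \<Rightarrow> 'a set \<Rightarrow> 'a set" where
  "strong_eq_solutions f C K = {x \<in> K. \<forall>z\<in>K. f x z \<in> C}"

text \<open>As usual in variational analysis, \<open>t\<^sub>k \<down> 0\<close> means that \<open>t\<^sub>k\<close> tends to 0 through
  positive values; monotonicity is not required (passing to a subsequence would provide it).\<close>

definition contingent_cone :: "'a::real_normed_vector \<Rightarrow> 'a set \<Rightarrow> 'a set" where
  "contingent_cone s S =
     {v. \<exists>(w :: nat \<Rightarrow> 'a) (t :: nat \<Rightarrow> real).
           w \<longlonglongrightarrow> v \<and> (\<forall>k. 0 < t k) \<and> t \<longlonglongrightarrow> 0 \<and> (\<forall>k. s + t k *\<^sub>R w k \<in> S)}"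

text \<open>Together with continuity, homogeneity for \<open>t > 0\<close> forces \<open>h 0 = 0\<close>.\<close>

definition PH :: "('a::real_normed_vector \<Rightarrow> 'b::real_normed_vector) set" where
  "PH = {h. continuous_on UNIV h \<and> (\<forall>t>0. \<forall>v. h (t *\<^sub>R v) = t *\<^sub>R h v)}"

text \<open>The supremum is taken in the extended reals, since on type \<open>real\<close> the supremum of an
  unbounded set is unspecified. Only the values \<open>D z\<close> with \<open>z \<in> K\<close> matter.\<close>

definition strictly_B_differentiable ::
    "('a::real_normed_vector \<Rightarrow> 'a \<Rightarrow> 'b::real_normed_vector) \<Rightarrow> 'a \<Rightarrow> 'a set
      \<Rightarrow> ('a \<Rightarrow> 'a \<Rightarrow> 'b) \<Rightarrow> bool" where
  "strictly_B_differentiable f xbar K D \<longleftrightarrow>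
     (\<forall>z\<in>K. D z \<in> PH) \<and>
     (\<forall>\<epsilon>>0. \<exists>\<delta>>0. \<forall>x1\<in>cball xbar \<delta>. \<forall>x2\<in>cball xbar \<delta>. x1 \<noteq> x2 \<longrightarrow>
        (SUP z\<in>K. ereal (norm (f x1 z - f x2 z - D z (x1 - x2)) / norm (x1 - x2))) < ereal \<epsilon>)"

definition equicontinuous_at ::
    "'i set \<Rightarrow> ('i \<Rightarrow> 'a::metric_space \<Rightarrow> 'b::metric_space) \<Rightarrow> 'a \<Rightarrow> bool" where
  "equicontinuous_at I h v \<longleftrightarrow>
     (\<forall>\<epsilon>>0. \<exists>\<delta>>0. \<forall>i\<in>I. \<forall>u. dist u v < \<delta> \<longrightarrow> dist (h i u) (h i v) < \<epsilon>)"

end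

theory Submission
  imports Defs
begin

text \<open>If \<open>xbar + t\<^sub>k w\<^sub>k\<close> solves the problem, with \<open>w\<^sub>k \<rightarrow> v\<close> and \<open>t\<^sub>k \<down> 0\<close>, then the difference quotients
  \<open>(f (xbar + t\<^sub>k w\<^sub>k) z - f xbar z) / t\<^sub>k\<close> are directions along which \<open>f xbar z\<close> moves into \<open>C\<close>.
  By positive homogeneity they differ from \<open>D z w\<^sub>k\<close> by \<open>o(norm w\<^sub>k)\<close>, so they converge to \<open>D z v\<close>.\<close>

lemma contingent_cone_mono:
  "S \<subseteq> T \<Longrightarrow> contingent_cone s S \<subseteq> contingent_cone s T"
  unfolding contingent_cone_def by blast

text \<open>Homogeneity with factor 2 at the origin gives
  \<open>h 0 = 2 *\<^sub>R h 0\<close>.\<close>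

lemma PH_zero:
  assumes "h \<in> PH"
  shows "h 0 = 0"
proof -
  have "h (2 *\<^sub>R 0) = (2::real) *\<^sub>R h 0"
    using assms unfolding PH_def by (metis (mono_tags, lifting) mem_Collect_eq zero_less_numeral)
  then show ?thesis
    by (simp add: scaleR_2)
qed

text \<open>Freezing \<open>x2 = xbar\<close> turns strict differentiability into a first-order
  expansion at \<open>xbar\<close>. Multiplying out the quotient lets the estimate include
  \<open>x = xbar\<close>.\<close>

lemma strictly_B_differentiable_remainder:
  assumes sB: "strictly_B_differentiable f xbar K D" and z: "z \<in> K" and e: "\<epsilon> > 0"
  obtains \<delta> where "\<delta> > 0"
    "\<And>x. dist xbar x \<le> \<delta> \<Longrightarrow>
       norm (f x z - f xbar z - D z (x - xbar)) \<le> \<epsilon> * norm (x - xbar)"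
proof -
  obtain \<delta> where \<delta>: "\<delta> > 0" and sup: "\<And>x1 x2. x1 \<in> cball xbar \<delta> \<Longrightarrow> x2 \<in> cball xbar \<delta> \<Longrightarrow> x1 \<noteq> x2 \<Longrightarrow>
      (SUP z\<in>K. ereal (norm (f x1 z - f x2 z - D z (x1 - x2)) / norm (x1 - x2))) < ereal \<epsilon>"
    using sB e unfolding strictly_B_differentiable_def by meson
  have "norm (f x z - f xbar z - D z (x - xbar)) \<le> \<epsilon> * norm (x - xbar)"
    if x: "dist xbar x \<le> \<delta>" for x
  \<comment> \<open>The definition only covers distinct points; at \<open>x = xbar\<close> both
    sides vanish because \<open>D z 0 = 0\<close>.\<close>
  proof (cases "x = xbar")
    case True
    moreover have "D z 0 = 0"
      using sB z PH_zero unfolding strictly_B_differentiable_def by blast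
    ultimately show ?thesis by simp
  next
    case False
    let ?q = "\<lambda>z. ereal (norm (f x z - f xbar z - D z (x - xbar)) / norm (x - xbar))"
    \<comment> \<open>In the extended reals the supremum dominates each term without a boundedness
      check.\<close>
    have "?q z \<le> (SUP z\<in>K. ?q z)"
      by (rule SUP_upper) (rule z)
    also have "\<dots> < ereal \<epsilon>"
      using False x \<delta> by (intro sup) auto
    finally show ?thesis
      using False by (simp add: divide_simps)
  qed
  with \<delta> show ?thesis
    using that by blast
qed

text \<open>The quotient is \<open>D z (w k)\<close>, which tends to \<open>D z v\<close> by
  continuity of \<open>D z\<close>, plus a rescaled remainder that tends to 0.\<close>

lemma difference_quotients_tendsto:
  assumes sB: "strictly_B_differentiable f xbar K D" and z: "z \<in> K"
    and w: "w \<longlonglongrightarrow> v" and t: "t \<longlonglongrightarrow> 0" and pos: "\<And>k::nat. 0 < t k"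
  shows "(\<lambda>k. inverse (t k) *\<^sub>R (f (xbar + t k *\<^sub>R w k) z - f xbar z)) \<longlonglongrightarrow> D z v"
proof -
  define u where "u k = inverse (t k) *\<^sub>R (f (xbar + t k *\<^sub>R w k) z - f xbar z)" for k
  have DPH: "D z \<in> PH"
    using sB z unfolding strictly_B_differentiable_def by blast
  have Dw: "(\<lambda>k. D z (w k)) \<longlonglongrightarrow> D z v"
    using DPH w unfolding PH_def by (auto intro: continuous_on_tendsto_compose)
  \<comment> \<open>A bound on all directions makes a remainder that is small relative to
    \<open>norm (w k)\<close> small in absolute terms.\<close>
  obtain M where M: "M > 0" "\<And>k. norm (w k) \<le> M"
    using convergent_imp_Bseq[OF convergentI[OF w]] by (auto elim: BseqE)
  have tw: "(\<lambda>k. xbar + t k *\<^sub>R w k) \<longlonglongrightarrow> xbar"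
    using tendsto_add[OF tendsto_const[of xbar] tendsto_scaleR[OF t w]] by simp
  have "(\<lambda>k. u k - D z (w k)) \<longlonglongrightarrow> 0"
  proof (rule tendstoI)
    fix e :: real assume e: "e > 0"
    \<comment> \<open>With this tolerance the final bound is \<open>e / 2\<close>, hence strictly
      below \<open>e\<close>.\<close>
    then have "e / (2 * M) > 0"
      using M by simp
    then obtain \<delta> where \<delta>: "\<delta> > 0" "\<And>x. dist xbar x \<le> \<delta> \<Longrightarrow>
        norm (f x z - f xbar z - D z (x - xbar)) \<le> e / (2 * M) * norm (x - xbar)"
      using strictly_B_differentiable_remainder[OF sB z] by blast
    from tendstoD[OF tw \<delta>(1)]
    show "eventually (\<lambda>k. dist (u k - D z (w k)) 0 < e) sequentially"
    proof eventually_elim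
      case (elim k)
      let ?r = "f (xbar + t k *\<^sub>R w k) z - f xbar z - D z (t k *\<^sub>R w k)"
      have r: "norm ?r \<le> e / (2 * M) * (t k * norm (w k))"
        using \<delta>(2)[of "xbar + t k *\<^sub>R w k"] elim pos[of k] by (simp add: dist_commute)
      \<comment> \<open>Homogeneity pulls out \<open>t k\<close>, so dividing the remainder
        \<open>?r\<close> by \<open>t k\<close> leaves exactly
        \<open>u k - D z (w k)\<close>.\<close>
      have "D z (t k *\<^sub>R w k) = t k *\<^sub>R D z (w k)"
        using DPH pos unfolding PH_def by blast
      then have "u k - D z (w k) = inverse (t k) *\<^sub>R ?r"
        using pos[of k] by (simp add: u_def algebra_simps)
      then have "norm (u k - D z (w k)) = norm ?r / t k"
        using pos[of k] by (simp add: divide_simps)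
      also have "\<dots> \<le> e / (2 * M) * norm (w k)"
        using r pos[of k] by (simp add: pos_divide_le_eq mult_ac)
      also have "\<dots> \<le> e / (2 * M) * M"
        using M e by (intro mult_left_mono) auto
      also have "\<dots> < e"
        using M e by simp
      finally show ?case by simp
    qed
  qed
  from tendsto_add[OF this Dw] show ?thesis
    by (simp add: u_def)
qed

theorem theorem3p3:
  fixes f :: "real^'n \<Rightarrow> real^'n \<Rightarrow> real^'m"
    and C :: "(real^'m) set"
    and K :: "(real^'n) set"
    and D :: "real^'n \<Rightarrow> real^'n \<Rightarrow> real^'m"
    and xbar :: "real^'n"
  assumes "closed C" and "convex C" and "cone C" and "pointed C" and "C \<noteq> {0}"
    and "closed K" and "K \<noteq> {}"
    and "xbar \<in> strong_eq_solutions f C K"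
    and "strictly_B_differentiable f xbar K D"
    and "\<forall>v. equicontinuous_at K D v"
  shows "contingent_cone xbar (strong_eq_solutions f C K)
           \<subseteq> (\<Inter>z\<in>K. D z -` contingent_cone (f xbar z) C) \<inter> contingent_cone xbar K"
proof (rule Int_greatest)
  show "contingent_cone xbar (strong_eq_solutions f C K) \<subseteq> contingent_cone xbar K"
    by (rule contingent_cone_mono) (auto simp: strong_eq_solutions_def)
  show "contingent_cone xbar (strong_eq_solutions f C K)
          \<subseteq> (\<Inter>z\<in>K. D z -` contingent_cone (f xbar z) C)"
  proof (intro subsetI INT_I vimageI2)
    fix v z assume "v \<in> contingent_cone xbar (strong_eq_solutions f C K)" and z: "z \<in> K"
    then obtain w t where w: "w \<longlonglongrightarrow> v" and pos: "\<And>k::nat. 0 < t k" and t: "t \<longlonglongrightarrow> 0"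
      and sol: "\<And>k. xbar + t k *\<^sub>R w k \<in> strong_eq_solutions f C K"
      unfolding contingent_cone_def by blast
    let ?u = "\<lambda>k. inverse (t k) *\<^sub>R (f (xbar + t k *\<^sub>R w k) z - f xbar z)"
    \<comment> \<open>The scalars cancel and leave \<open>f (xbar + t k *\<^sub>R w k) z\<close>,
      which lies in \<open>C\<close> because its first argument is a solution. Thus
      \<open>?u\<close> and the same \<open>t\<close> witness the tangency of
      \<open>D z v\<close>.\<close>
    have "f xbar z + t k *\<^sub>R ?u k \<in> C" for k
      using sol[of k] z pos[of k] by (simp add: strong_eq_solutions_def)
    moreover have "?u \<longlonglongrightarrow> D z v"
      by (rule difference_quotients_tendsto[OF assms(9) z w t pos])
    ultimately show "D z v \<in> contingent_cone (f xbar z) C"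
      unfolding contingent_cone_def using pos t by blast
  qed
qed

end
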